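(* Let $R$ be a $*$-reducing ring and let $p, q\in R$ be projections such that $1-qp\in R^{\dag}$. Write $\overline{p} = 1-p$ and $\overline{q} = 1-q$. Then $p+q-qp\in R^{\dag}$ and: (1) $(1-qp)^{\dag}\overline{q}$ and $p(p+q-qp)^{\dag}$ are idempotents; (2) $[(1-qp)^{\dag}\overline{q}]R = [pR\cap (\overline{p}R+\overline{q}R)]\oplus^{\bot} (\overline{p}R\cap\overline{q}R)$; (3) $[1-(1-qp)^{\dag}\overline{q}]R = qR$; (4) $[p(p+q-qp)^{\dag}]R = pR$; (5) $[1-p(p+q-qp)^{\dag}]R = [(\overline{p}R+\overline{q}R)\cap qR]\oplus^{\bot} (\overline{p}R\cap\overline{q}R)$.
   Context: $R$ is an associative ring with unity and an involution $a\mapsto a^*$, i.e. $(a^* )^*=a$, $(a+b)^*=a^*+b^*$, $(ab)^*=b^*a^*$. $R$ is $*$-reducing if $a^*a=0$ implies $a=0$ for all $a\in R$. An element $a\in R$ is Moore-Penrose invertible (written $a\in R^{\dag}$) if there is $b\in R$ with $aba=a$, $bab=b$, $(ab)^*=ab$, $(ba)^*=ba$; such $b$ is unique and denoted $a^{\dag}$. A projection is an element $p$ with $p^2=p=p^*$. For $x\in R$, $xR$ is the right ideal generated by $x$. For subsets $X,Y\subseteq R$, $X\bot Y$ means $y^*x=0$ for all $x\in X$, $y\in Y$. For right ideals $X,Y,Z$, the equality $Z = X\oplus^{\bot}Y$ means $Z=X+Y$ and $X\bot Y$ (in a $*$-reducing ring, $X\bot Y$ implies $X\cap Y=\{0\}$).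 *)

theory Defs
  imports Main "HOL-Library.Set_Algebras"
begin

text \<open>
  The sort \<open>{ring, monoid_mult}\<close> is that of associative, not necessarily commutative rings
  with unity. It is used rather than \<open>ring_1\<close>, which would also demand \<open>0 \<noteq> 1\<close>.
\<close>

locale ring_involution =
  fixes star :: "'a::{ring, monoid_mult} \<Rightarrow> 'a"
  assumes star_star: "star (star a) = a"
    and star_add: "star (a + b) = star a + star b"
    and star_mult: "star (a * b) = star b * star a"

definition star_reducing :: "('a::{ring, monoid_mult} \<Rightarrow> 'a) \<Rightarrow> bool" where
  "star_reducing star \<longleftrightarrow> (\<forall>a. star a * a = 0 \<longrightarrow> a = 0)"

definition is_mp_inverse :: "('a::{ring, monoid_mult} \<Rightarrow> 'a) \<Rightarrow> 'a \<Rightarrow> 'a \<Rightarrow> bool" where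
  "is_mp_inverse star a b \<longleftrightarrow>
     a * b * a = a \<and> b * a * b = b \<and> star (a * b) = a * b \<and> star (b * a) = b * a"

definition mp_invertible :: "('a::{ring, monoid_mult} \<Rightarrow> 'a) \<Rightarrow> 'a \<Rightarrow> bool" where
  "mp_invertible star a \<longleftrightarrow> (\<exists>b. is_mp_inverse star a b)"

definition mp_inverse :: "('a::{ring, monoid_mult} \<Rightarrow> 'a) \<Rightarrow> 'a \<Rightarrow> 'a" where
  "mp_inverse star a = (THE b. is_mp_inverse star a b)"

definition is_projection :: "('a::{ring, monoid_mult} \<Rightarrow> 'a) \<Rightarrow> 'a \<Rightarrow> bool" where
  "is_projection star p \<longleftrightarrow> p * p = p \<and> star p = p"

definition idempotent_elem :: "'a::{ring, monoid_mult} \<Rightarrow> bool" where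
  "idempotent_elem e \<longleftrightarrow> e * e = e"

definition right_ideal_gen :: "'a::{ring, monoid_mult} \<Rightarrow> 'a set" where
  "right_ideal_gen x = {x * r | r. True}"

definition star_orthogonal ::
  "('a::{ring, monoid_mult} \<Rightarrow> 'a) \<Rightarrow> 'a set \<Rightarrow> 'a set \<Rightarrow> bool" where
  "star_orthogonal star X Y \<longleftrightarrow> (\<forall>x\<in>X. \<forall>y\<in>Y. star y * x = 0)"

text \<open>
  \<open>orthogonal_sum star Z X Y\<close> expresses that \<open>Z\<close> is the orthogonal direct sum of \<open>X\<close> and \<open>Y\<close>.
  In \<open>Z = X + Y\<close>, \<open>+\<close> is the elementwise sum of sets.
\<close>

definition orthogonal_sum ::
  "('a::{ring, monoid_mult} \<Rightarrow> 'a) \<Rightarrow> 'a set \<Rightarrow> 'a set \<Rightarrow> 'a set \<Rightarrow> bool" where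
  "orthogonal_sum star Z X Y \<longleftrightarrow> Z = X + Y \<and> star_orthogonal star X Y"

context ring_involution
begin

lemma is_mp_inverse_unique:
  assumes b: "is_mp_inverse star a b" and c: "is_mp_inverse star a c"
  shows "b = c"
proof -
  have b1: "a * b * a = a" "b * a * b = b" "star (a * b) = a * b" "star (b * a) = b * a"
    and c1: "a * c * a = a" "c * a * c = c" "star (a * c) = a * c" "star (c * a) = c * a"
    using b c by (simp_all add: is_mp_inverse_def)
  have "a * b = star ((a * c) * (a * b))"
    using b1 c1 by (metis mult.assoc)
  also have "\<dots> = (a * b) * (a * c)"
    by (simp only: star_mult[of "a * c" "a * b"] b1 c1)
  also have "\<dots> = a * c"
    using b1 by (metis mult.assoc)
  finally have ab: "a * b = a * c" .
  have "b * a = star ((b * a) * (c * a))"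
    using b1 c1 by (metis mult.assoc)
  also have "\<dots> = (c * a) * (b * a)"
    by (simp only: star_mult[of "b * a" "c * a"] b1 c1)
  also have "\<dots> = c * a"
    using b1 by (metis mult.assoc)
  finally have ba: "b * a = c * a" .
  have "b = b * (a * b)" using b1 by (simp add: mult.assoc)
  also have "\<dots> = c * a * c" using ab ba by (metis mult.assoc)
  finally show ?thesis using c1 by simp
qed

lemma is_mp_inverse_mp_inverse:
  assumes "mp_invertible star a"
  shows "is_mp_inverse star a (mp_inverse star a)"
  using assms is_mp_inverse_unique unfolding mp_invertible_def mp_inverse_def
  by (metis theI)

lemma mp_inverse_eqI:
  assumes "is_mp_inverse star a b"
  shows "mp_inverse star a = b"
  using assms is_mp_inverse_unique unfolding mp_inverse_def by blast

end

end

theory Submission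
  imports Defs
begin

text \<open>
  Write \<open>a = 1 - q p\<close> and let \<open>c\<close> be its Moore-Penrose inverse. The projections \<open>1 - c a\<close> and
  \<open>1 - a c\<close> are annihilated on the left by \<open>1 - q p\<close> and \<open>1 - p q\<close> respectively, and in a
  \<open>*\<close>-reducing ring \<open>q p z = z\<close> for a self-adjoint \<open>z\<close> forces \<open>p z = z = q z\<close>
  (\<open>fixed_by_product_of_projections\<close>). So both are the same projection \<open>e\<close>, the one onto \<open>p R \<inter> q R\<close>, and
  \<open>(1 - p) R + (1 - q) R = (1 - e) R\<close> is the kernel of \<open>e\<close>.

  The heuristic for \<open>b = p + q - q p\<close> is the identity
  \<open>b a\<^sup>* = a\<^sup>* b = (p - q)\<^sup>2\<close>, where \<open>(p - q)\<^sup>2\<close> commutes with \<open>p\<close> and \<open>q\<close>. If \<open>T\<close> is the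
  Moore-Penrose inverse of \<open>(p - q)\<^sup>2\<close>, then \<open>T (1 - p q) + e\<close> should be that of \<open>b\<close>. The products \<open>T p\<close> and \<open>T q\<close>
  are \<open>x = p c\<close> and \<open>y = c q\<close>, and
  \<open>T (1 - p) = (1 - p) y y (1 - p)\<close>, which gives the candidate
  \<open>(1 - p) y y (1 - p) + x (1 - q) + e\<close>; it is checked directly
  (\<open>is_mp_inverse_complement\<close>).

  It follows that \<open>f = c (1 - q)\<close> and \<open>w = p b\<^sup>\<dagger> = x (1 - q) + e\<close> satisfy
  \<open>(1 - q) f = 1 - q\<close>, \<open>f (1 - q) = f\<close>, \<open>p w = w\<close> and \<open>w p = p\<close>. So they are idempotent, the kernel of \<open>f\<close> is
  \<open>q R\<close>, and the range of \<open>w\<close> is \<open>p R\<close>. Splitting the range of \<open>f\<close> along \<open>p\<close> and the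
  kernel of \<open>w\<close> along \<open>q\<close> yields the two orthogonal sums.
\<close>

lemma mult_eq_assoc:
  fixes u v w z :: "'a::semigroup_mult"
  assumes "u * v = w"
  shows "u * (v * z) = w * z"
  using assms by (simp add: mult.assoc[symmetric])

lemma mem_right_ideal_gen_idempotent_iff:
  assumes "idempotent_elem h"
  shows "z \<in> right_ideal_gen h \<longleftrightarrow> h * z = z"
  using assms mult_eq_assoc[of h h h] unfolding idempotent_elem_def right_ideal_gen_def
  by (auto intro: sym)

lemma idempotent_elem_complement:
  "idempotent_elem h \<Longrightarrow> idempotent_elem (1 - h)"
  by (simp add: idempotent_elem_def algebra_simps)

lemma mem_right_ideal_gen_complement_iff:
  assumes "idempotent_elem h"
  shows "z \<in> right_ideal_gen (1 - h) \<longleftrightarrow> h * z = 0"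
  using mem_right_ideal_gen_idempotent_iff[OF idempotent_elem_complement[OF assms], of z]
  by (simp add: left_diff_distrib)

context ring_involution
begin

lemma star_zero: "star 0 = 0"
  using star_add[of 0 0] by simp

lemma star_minus: "star (- u) = - star u"
  using star_add[of u "- u"] by (simp add: star_zero eq_neg_iff_add_eq_0 add.commute)

lemma star_diff: "star (u - v) = star u - star v"
  using star_add[of u "- v"] by (simp add: star_minus)

lemma star_one: "star 1 = 1"
  by (metis star_mult star_star mult_1_left mult_1_right)

text \<open>
  In operator terms: a vector fixed by \<open>q p\<close> is fixed by both projections, because projections
  do not increase norms. Here \<open>*\<close>-reducedness takes the place of the norm.
\<close>

lemma fixed_by_product_of_projections:
  assumes red: "star_reducing star"
    and p: "is_projection star p" and q: "is_projection star q" and z: "star z = z"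
    and fixed: "q * p * z = z"
  shows "p * z = z" and "q * z = z"
proof -
  have pp: "p * p = p" "star p = p" and qq: "q * q = q" "star q = q"
    using p q by (auto simp: is_projection_def)
  show qz: "q * z = z"
    by (metis fixed qq(1) mult.assoc)
  have "star (q * p * z) = z * p * q"
    by (simp add: star_mult pp qq z mult.assoc)
  then have zpq: "z * p * q = z"
    using fixed z by simp
  have "z * p * z = z * z"
    by (metis qz zpq mult.assoc)
  moreover have "star (p * z - z) * (p * z - z) = z * z - z * p * z"
    using pp by (simp add: star_diff star_mult z algebra_simps mult_eq_assoc[OF pp(1)])
  ultimately have "star (p * z - z) * (p * z - z) = 0"
    by simp
  then have "p * z - z = 0"
    using red unfolding star_reducing_def by blast
  then show "p * z = z"
    by simp
qed

end

section \<open>Two projections with \<open>1 - q p\<close> Moore-Penrose invertible\<close>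

locale mp_projection_pair = ring_involution star
  for star :: "'a::{ring, monoid_mult} \<Rightarrow> 'a" +
  fixes p q :: 'a
  assumes reducing: "star_reducing star"
    and proj_p: "is_projection star p"
    and proj_q: "is_projection star q"
    and mp: "mp_invertible star (1 - q * p)"
begin

text \<open>The Moore-Penrose inverse of \<open>1 - q p\<close>, as a fixed element of the ring.\<close>

definition c :: 'a where
  "c = mp_inverse star (1 - q * p)"

text \<open>The projection onto \<open>p R \<inter> q R\<close>, which is the kernel of \<open>1 - q p\<close>.\<close>

definition e :: 'a where
  "e = 1 - c * (1 - q * p)"

text \<open>
  The elements \<open>x\<close> and \<open>y\<close> are the inverses of the compressions
  \<open>p (p - q)\<^sup>2 p = p (1 - q) p\<close> and \<open>q (p - q)\<^sup>2 q = q (1 - p) q\<close> in the corner rings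
  \<open>(p - e) R (p - e)\<close> and \<open>(q - e) R (q - e)\<close>; the lemmas \<open>compression_x\<close>, \<open>x_compression\<close>
  and their counterparts for \<open>y\<close> say so.
\<close>

definition x :: 'a where
  "x = p * c"

definition y :: 'a where
  "y = c * q"

lemma idem_p: "p * p = p" and star_p: "star p = p"
  and idem_q: "q * q = q" and star_q: "star q = q"
  using proj_p proj_q by (auto simp: is_projection_def)

lemma is_mp_inverse_c: "is_mp_inverse star (1 - q * p) c"
  unfolding c_def by (rule is_mp_inverse_mp_inverse[OF mp])

lemma c_mult: "c * (1 - q * p) = 1 - e"
  by (simp add: e_def)

lemma star_e: "star e = e"
  using is_mp_inverse_c by (simp add: e_def star_diff star_one is_mp_inverse_def)

lemma p_e: "p * e = e" and q_e: "q * e = e"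
proof -
  have "(1 - q * p) * c * (1 - q * p) = 1 - q * p"
    using is_mp_inverse_c by (simp add: is_mp_inverse_def)
  then have "(1 - q * p) * e = 0"
    by (simp add: e_def right_diff_distrib mult.assoc)
  then have "q * p * e = e"
    by (simp add: left_diff_distrib)
  then show "p * e = e" "q * e = e"
    using fixed_by_product_of_projections[OF reducing proj_p proj_q star_e] by auto
qed

lemma e_p: "e * p = e"
  using arg_cong[OF p_e, of star] by (simp add: star_mult star_e star_p)

lemma e_q: "e * q = e"
  using arg_cong[OF q_e, of star] by (simp add: star_mult star_e star_q)

lemma mult_c: "(1 - q * p) * c = 1 - e"
proof -
  define d where "d = 1 - (1 - q * p) * c"
  have star_d: "star d = d"
    using is_mp_inverse_c by (simp add: d_def star_diff star_one is_mp_inverse_def)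
  have "(1 - q * p) * c * (1 - q * p) = 1 - q * p"
    using is_mp_inverse_c by (simp add: is_mp_inverse_def)
  then have "d * (1 - q * p) = 0"
    by (simp add: d_def left_diff_distrib)
  then have "star (d * (1 - q * p)) = 0"
    by (simp add: star_zero)
  then have "p * q * d = d"
    by (simp add: star_mult star_diff star_one star_p star_q star_d left_diff_distrib)
  then have "q * d = d" "p * d = d"
    using fixed_by_product_of_projections[OF reducing proj_q proj_p star_d] by auto
  then have "(1 - q * p) * d = 0"
    by (simp add: left_diff_distrib mult.assoc)
  then have ed: "e * d = d"
    by (simp add: e_def left_diff_distrib mult.assoc)
  have "e * (1 - q * p) = 0"
    by (simp add: right_diff_distrib mult.assoc[symmetric] e_q e_p)
  then have "e * d = e"
    by (simp add: d_def right_diff_distrib mult.assoc[symmetric])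
  then have "d = e"
    using ed by simp
  then show ?thesis
    by (simp add: d_def algebra_simps)
qed

lemma e_idem: "e * e = e"
  by (subst (1) e_def) (simp add: left_diff_distrib mult.assoc p_e q_e)

lemma c_e: "c * e = 0"
proof -
  have "c * ((1 - q * p) * c) = c"
    using is_mp_inverse_c by (simp add: is_mp_inverse_def mult.assoc)
  then show ?thesis
    unfolding mult_c by (simp add: right_diff_distrib)
qed

lemma e_c: "e * c = 0"
proof -
  have "c * (1 - q * p) * c = c"
    using is_mp_inverse_c by (simp add: is_mp_inverse_def)
  then show ?thesis
    unfolding c_mult by (simp add: left_diff_distrib)
qed

lemma q_complement_c: "(1 - q) * c = 1 - q"
proof -
  have "(1 - q) * (1 - q * p) = 1 - q"
    by (simp add: algebra_simps idem_q mult_eq_assoc[OF idem_q])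
  then have "(1 - q) * c = (1 - q) * ((1 - q * p) * c)"
    by (simp add: mult.assoc[symmetric])
  then show ?thesis
    unfolding mult_c by (simp add: algebra_simps q_e)
qed

lemma c_p_complement: "c * (1 - p) = 1 - p"
proof -
  have "(1 - q * p) * (1 - p) = 1 - p"
    by (simp add: algebra_simps idem_p)
  then have "c * (1 - p) = c * (1 - q * p) * (1 - p)"
    by (simp add: mult.assoc)
  then show ?thesis
    unfolding c_mult by (simp add: algebra_simps e_p)
qed

section \<open>The elements \<open>x\<close> and \<open>y\<close>\<close>

lemma p_x: "p * x = x" and e_x: "e * x = 0" and x_e: "x * e = 0"
  by (simp_all add: x_def mult.assoc[symmetric] idem_p e_p e_c) (simp add: mult.assoc c_e)

lemma y_q: "y * q = y" and y_e: "y * e = 0" and e_y: "e * y = 0"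
  by (simp_all add: y_def mult.assoc idem_q q_e c_e) (simp add: mult.assoc[symmetric] e_c)

lemma x_p: "x * p = x"
proof -
  have "x * (1 - p) = p * (1 - p)"
    by (simp add: x_def mult.assoc c_p_complement)
  then show ?thesis
    by (simp add: right_diff_distrib idem_p)
qed

lemma q_y: "q * y = y"
proof -
  have "(1 - q) * y = (1 - q) * q"
    by (simp add: y_def mult.assoc[symmetric] q_complement_c)
  then show ?thesis
    by (simp add: left_diff_distrib idem_q)
qed

lemma compression_x: "p * ((1 - q) * x) = p - e"
proof -
  have "p * ((1 - q) * x) = p * ((1 - q * p) * c)"
    by (simp add: x_def algebra_simps mult_eq_assoc[OF idem_p])
  then show ?thesis
    unfolding mult_c by (simp add: right_diff_distrib p_e)
qed

lemma y_compression: "y * ((1 - p) * q) = q - e"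
proof -
  have "y * ((1 - p) * q) = c * (1 - q * p) * q"
    by (simp add: y_def algebra_simps idem_q mult_eq_assoc[OF idem_q])
  then show ?thesis
    unfolding c_mult by (simp add: left_diff_distrib e_q)
qed

lemma star_compression:
  "star (u * ((1 - v) * w)) = star w * ((1 - star v) * star u)"
  by (simp add: star_mult star_diff star_one mult.assoc)

text \<open>Both are one-sided inverses of a self-adjoint element of a corner ring, hence self-adjoint.\<close>

lemma star_x: "star x = x"
proof -
  have inv: "star x * ((1 - q) * p) = p - e"
    using arg_cong[OF compression_x, of star]
    by (simp add: star_compression star_diff star_p star_q star_e)
  have "star x * p = star x"
    using arg_cong[OF p_x, of star] by (simp add: star_mult star_p)
  moreover have "star x * e = 0"
    using arg_cong[OF e_x, of star] by (simp add: star_mult star_e star_zero)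
  ultimately have "star x = star x * (p - e)"
    by (simp add: right_diff_distrib)
  also have "\<dots> = star x * p * ((1 - q) * x)"
    by (simp add: compression_x[symmetric] mult.assoc mult_eq_assoc[OF \<open>star x * p = star x\<close>])
  also have "\<dots> = star x * ((1 - q) * p) * x"
    by (simp add: \<open>star x * p = star x\<close> mult.assoc p_x)
  also have "\<dots> = x"
    unfolding inv by (simp add: left_diff_distrib p_x e_x)
  finally show ?thesis .
qed

lemma star_y: "star y = y"
proof -
  have inv: "q * ((1 - p) * star y) = q - e"
    using arg_cong[OF y_compression, of star]
    by (simp add: star_compression star_diff star_p star_q star_e)
  have q_sy: "q * star y = star y"
    using arg_cong[OF y_q, of star] by (simp add: star_mult star_q)
  have e_sy: "e * star y = 0"
    using arg_cong[OF y_e, of star] by (simp add: star_mult star_e star_zero)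
  have "y = y * (q - e)"
    by (simp add: right_diff_distrib y_q y_e)
  also have "\<dots> = y * q * ((1 - p) * star y)"
    by (simp add: inv[symmetric] mult.assoc)
  also have "\<dots> = y * ((1 - p) * q) * star y"
    by (simp add: mult.assoc y_q q_sy)
  also have "\<dots> = star y"
    unfolding y_compression by (simp add: left_diff_distrib q_sy e_sy)
  finally show ?thesis by simp
qed

lemma x_compression: "x * ((1 - q) * p) = p - e"
  using arg_cong[OF compression_x, of star]
  by (simp add: star_compression star_diff star_p star_q star_e star_x)

lemma compression_y: "q * ((1 - p) * y) = q - e"
  using arg_cong[OF y_compression, of star]
  by (simp add: star_compression star_diff star_p star_q star_e star_y)

text \<open>Both sides stand for \<open>p T q\<close>, where \<open>T\<close> is the Moore-Penrose inverse of \<open>(p - q)\<^sup>2\<close>.\<close>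

lemma x_q_eq_p_y: "x * q = p * y"
proof -
  \<comment> \<open>Both sides are \<open>p (p - q)\<^sup>2 q\<close>, because \<open>(p - q)\<^sup>2\<close> commutes with \<open>p\<close> and \<open>q\<close>.\<close>
  have commute: "p * (q * ((1 - p) * q)) = p * ((1 - q) * (p * q))"
    by (simp add: algebra_simps idem_q mult_eq_assoc[OF idem_p])
  have "x * q = x * (q * (q - e))"
    by (simp add: right_diff_distrib idem_q q_e x_e)
  also have "\<dots> = x * p * (q * (q * ((1 - p) * (q * y))))"
    by (simp add: compression_y q_y x_p)
  also have "\<dots> = x * ((p * (q * ((1 - p) * q))) * y)"
    by (simp add: mult.assoc mult_eq_assoc[OF idem_q])
  also have "\<dots> = x * p * ((1 - q) * (p * (q * y)))"
    unfolding commute by (simp add: mult.assoc)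
  also have "\<dots> = x * ((1 - q) * p) * y"
    by (simp add: x_p q_y mult.assoc)
  also have "\<dots> = p * y"
    unfolding x_compression by (simp add: left_diff_distrib e_y)
  finally show ?thesis .
qed

section \<open>The Moore-Penrose inverse of \<open>p + q - q p\<close>\<close>

text \<open>
  The name refers to \<open>p + q - q p = 1 - (1 - q) (1 - p)\<close>, which is \<open>1 - q p\<close> for the
  complementary projections. In terms of the Moore-Penrose inverse \<open>T\<close> of \<open>(p - q)\<^sup>2\<close>, the
  element is \<open>T (1 - p q) + e = T (1 - p) + T p (1 - q) + e\<close>.
\<close>

definition mp_complement :: 'a where
  "mp_complement = (1 - p) * (y * (y * (1 - p))) + x * (1 - q) + e"

lemma mult_mp_complement:
  "(p + q - q * p) * mp_complement = y * (1 - p) + x * (1 - q) + e"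
proof -
  have "(p + q - q * p) * ((1 - p) * (y * (y * (1 - p)))) = (q * ((1 - p) * y)) * (y * (1 - p))"
    by (simp add: algebra_simps mult_eq_assoc[OF idem_p])
  also have "\<dots> = y * (1 - p)"
    unfolding compression_y
    by (simp add: left_diff_distrib mult_eq_assoc[OF q_y] mult_eq_assoc[OF e_y])
  finally have 1: "(p + q - q * p) * ((1 - p) * (y * (y * (1 - p)))) = y * (1 - p)" .
  have 2: "(p + q - q * p) * (x * (1 - q)) = x * (1 - q)"
    by (simp add: distrib_right left_diff_distrib mult.assoc mult_eq_assoc[OF p_x])
  have 3: "(p + q - q * p) * e = e"
    by (simp add: distrib_right left_diff_distrib mult.assoc p_e q_e)
  show ?thesis
    by (simp only: mp_complement_def distrib_left 1 2 3)
qed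

lemma mp_complement_mult:
  "mp_complement * (p + q - q * p) = (1 - p) * (y * (1 - p)) + p"
proof -
  have b: "(1 - p) * (p + q - q * p) = (1 - p) * (q * (1 - p))"
    by (simp add: algebra_simps idem_p mult_eq_assoc[OF idem_p])
  have yy: "y * ((1 - p) * (q * (1 - p))) = q * (1 - p) - e * (1 - p)"
    using mult_eq_assoc[OF y_compression, of "1 - p"] by (simp add: mult.assoc left_diff_distrib)
  have "(1 - p) * (y * (y * (1 - p))) * (p + q - q * p) =
      (1 - p) * (y * (y * ((1 - p) * (q * (1 - p)))))"
    by (simp only: mult.assoc b)
  also have "\<dots> = (1 - p) * (y * (1 - p))"
    unfolding yy
    by (simp add: right_diff_distrib mult_eq_assoc[OF y_q] mult_eq_assoc[OF y_e] y_q y_e e_p)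
  finally have 1: "(1 - p) * (y * (y * (1 - p))) * (p + q - q * p) = (1 - p) * (y * (1 - p))" .
  have "x * (1 - q) * (p + q - q * p) = x * ((1 - q) * p)"
    by (simp add: algebra_simps idem_q mult_eq_assoc[OF idem_q])
  then have 2: "x * (1 - q) * (p + q - q * p) = p - e"
    by (simp only: x_compression)
  have 3: "e * (p + q - q * p) = e"
    by (simp add: distrib_left right_diff_distrib mult_eq_assoc[OF e_q] e_p e_q)
  show ?thesis
    by (simp add: mp_complement_def distrib_right 1 2 3)
qed

lemma p_mp_complement: "p * mp_complement = x * (1 - q) + e"
proof -
  have "p * ((1 - p) * (y * (y * (1 - p)))) = 0"
    by (simp add: mult.assoc[symmetric] right_diff_distrib idem_p)
  then show ?thesis
    by (simp add: mp_complement_def distrib_left mult_eq_assoc[OF p_x] p_e)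
qed

lemma is_mp_inverse_complement:
  "is_mp_inverse star (p + q - q * p) mp_complement"
  unfolding is_mp_inverse_def
proof (intro conjI)
  let ?b = "p + q - q * p"
  have "q * x = y * p"
    using arg_cong[OF x_q_eq_p_y, of star] by (simp add: star_mult star_p star_q star_x star_y)
  then show "star (?b * mp_complement) = ?b * mp_complement"
    unfolding mult_mp_complement
    by (simp add: star_add star_mult star_diff star_one star_p star_q star_x star_y star_e
        right_diff_distrib left_diff_distrib x_q_eq_p_y)
  show "star (mp_complement * ?b) = mp_complement * ?b"
    unfolding mp_complement_mult
    by (simp add: star_add star_mult star_diff star_one star_p star_y mult.assoc)
  have "y * (1 - p) * ?b = y * ((1 - p) * q) * (1 - p)"
    by (simp add: algebra_simps idem_p mult_eq_assoc[OF idem_p])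
  also have "\<dots> = q * (1 - p)"
    unfolding y_compression by (simp add: algebra_simps e_p)
  finally have 1: "y * (1 - p) * ?b = q * (1 - p)" .
  have "x * (1 - q) * ?b = x * ((1 - q) * p)"
    by (simp add: algebra_simps idem_q mult_eq_assoc[OF idem_q])
  then have 2: "x * (1 - q) * ?b = p - e"
    by (simp only: x_compression)
  have 3: "e * ?b = e"
    by (simp add: distrib_left right_diff_distrib mult_eq_assoc[OF e_q] e_p e_q)
  show "?b * mp_complement * ?b = ?b"
    unfolding mult_mp_complement distrib_right 1 2 3 by (simp add: right_diff_distrib)
  have yy: "y * ((1 - p) * y) = y"
  proof -
    have "y * ((1 - p) * y) = y * (q * ((1 - p) * y))"
      by (simp add: mult_eq_assoc[OF y_q])
    then show ?thesis
      by (simp add: compression_y right_diff_distrib y_q y_e)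
  qed
  have "(1 - p) * mp_complement = (1 - p) * (y * (y * (1 - p)))"
    unfolding left_diff_distrib p_mp_complement
    by (simp add: mp_complement_def left_diff_distrib)
  then have "(1 - p) * (y * (1 - p)) * mp_complement = (1 - p) * (y * (y * (1 - p)))"
    by (simp add: mult.assoc mult_eq_assoc[OF yy, unfolded mult.assoc])
  then show "mp_complement * ?b * mp_complement = mp_complement"
    unfolding mp_complement_mult distrib_right p_mp_complement
    by (simp add: mp_complement_def add.assoc)
qed

lemma mp_inverse_complement: "mp_inverse star (p + q - q * p) = mp_complement"
  by (rule mp_inverse_eqI[OF is_mp_inverse_complement])

section \<open>Ranges and kernels of the idempotents\<close>

lemma mem_range_p: "z \<in> right_ideal_gen p \<longleftrightarrow> p * z = z"
  and mem_range_q: "z \<in> right_ideal_gen q \<longleftrightarrow> q * z = z"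
  and mem_range_p_complement: "z \<in> right_ideal_gen (1 - p) \<longleftrightarrow> p * z = 0"
  and mem_range_q_complement: "z \<in> right_ideal_gen (1 - q) \<longleftrightarrow> q * z = 0"
  using idem_p idem_q
  by (simp_all add: mem_right_ideal_gen_idempotent_iff mem_right_ideal_gen_complement_iff
      idempotent_elem_def)

lemma mem_sum_of_complements:
  "z \<in> right_ideal_gen (1 - p) + right_ideal_gen (1 - q) \<longleftrightarrow> e * z = 0"
proof
  assume "z \<in> right_ideal_gen (1 - p) + right_ideal_gen (1 - q)"
  then obtain u v where "z = u + v" "p * u = 0" "q * v = 0"
    by (auto simp: set_plus_def mem_range_p_complement mem_range_q_complement)
  then show "e * z = 0"
    by (metis distrib_left e_p e_q mult.assoc mult_zero_right add_0)
next
  assume "e * z = 0"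
  \<comment> \<open>\<open>1 - e = (1 - q p) c\<close>, and \<open>1 - q p = (1 - p) + (1 - q) p\<close>.\<close>
  then have "z = (1 - q * p) * c * z"
    unfolding mult_c by (simp add: left_diff_distrib)
  also have "\<dots> = (1 - p) * (c * z) + (1 - q) * (p * (c * z))"
    by (simp add: algebra_simps)
  finally show "z \<in> right_ideal_gen (1 - p) + right_ideal_gen (1 - q)"
    unfolding set_plus_def right_ideal_gen_def by blast
qed

lemma idempotent_c: "idempotent_elem (c * (1 - q))"
  and range_complement_c: "right_ideal_gen (1 - c * (1 - q)) = right_ideal_gen q"
proof -
  have idem: "(1 - q) * (1 - q) = 1 - q"
    by (simp add: algebra_simps idem_q)
  have f: "(1 - q) * (c * (1 - q)) = 1 - q"
    by (simp add: mult_eq_assoc[OF q_complement_c] idem)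
  show id: "idempotent_elem (c * (1 - q))"
    by (simp add: idempotent_elem_def mult.assoc f)
  have "c * (1 - q) * z = 0 \<longleftrightarrow> q * z = z" for z
  proof
    assume "c * (1 - q) * z = 0"
    then have "(1 - q) * (c * (1 - q)) * z = 0"
      by (simp add: mult.assoc)
    then show "q * z = z"
      unfolding f by (simp add: left_diff_distrib)
  next
    assume "q * z = z"
    then show "c * (1 - q) * z = 0"
      by (simp add: mult.assoc left_diff_distrib)
  qed
  then show "right_ideal_gen (1 - c * (1 - q)) = right_ideal_gen q"
    using mem_right_ideal_gen_complement_iff[OF id] mem_range_q by blast
qed

lemma idempotent_p_mp_complement: "idempotent_elem (p * mp_complement)"
  and range_p_mp_complement: "right_ideal_gen (p * mp_complement) = right_ideal_gen p"
proof -
  have wp: "p * mp_complement * p = p"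
    unfolding p_mp_complement distrib_right by (simp add: mult.assoc x_compression e_p)
  show id: "idempotent_elem (p * mp_complement)"
    by (simp add: idempotent_elem_def mult.assoc[symmetric] wp)
  have "p * mp_complement * z = z \<longleftrightarrow> p * z = z" for z
    by (metis wp idem_p mult.assoc)
  then show "right_ideal_gen (p * mp_complement) = right_ideal_gen p"
    using mem_right_ideal_gen_idempotent_iff[OF id] mem_range_p by blast
qed

lemma mem_kernel_p_mp_complement:
  "z \<in> right_ideal_gen (1 - p * mp_complement) \<longleftrightarrow> p * ((1 - q) * z) = 0 \<and> e * z = 0"
proof -
  have "p * mp_complement * z = 0 \<longleftrightarrow> p * ((1 - q) * z) = 0 \<and> e * z = 0"
  proof
    assume "p * mp_complement * z = 0"
    then have 0: "x * ((1 - q) * z) + e * z = 0"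
      by (simp add: p_mp_complement distrib_right mult.assoc)
    then have "e * (x * ((1 - q) * z) + e * z) = 0"
      by simp
    then have ez: "e * z = 0"
      by (simp add: distrib_left mult_eq_assoc[OF e_x] mult_eq_assoc[OF e_idem])
    have "p * ((1 - q) * z) = (p - e) * ((1 - q) * z)"
      by (simp add: algebra_simps mult_eq_assoc[OF e_q])
    also have "\<dots> = p * ((1 - q) * (x * ((1 - q) * z)))"
      by (simp only: compression_x[symmetric] mult.assoc)
    also have "\<dots> = 0"
      using 0 ez by simp
    finally show "p * ((1 - q) * z) = 0 \<and> e * z = 0"
      using ez by simp
  next
    assume "p * ((1 - q) * z) = 0 \<and> e * z = 0"
    then show "p * mp_complement * z = 0"
      by (metis p_mp_complement x_p distrib_right mult.assoc mult_zero_right add_0)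
  qed
  then show ?thesis
    using mem_right_ideal_gen_complement_iff[OF idempotent_p_mp_complement] by simp
qed

lemma orthogonal_sum_range_c:
  "orthogonal_sum star (right_ideal_gen (c * (1 - q)))
    (right_ideal_gen p \<inter> (right_ideal_gen (1 - p) + right_ideal_gen (1 - q)))
    (right_ideal_gen (1 - p) \<inter> right_ideal_gen (1 - q))"
  (is "orthogonal_sum star ?Z ?X ?Y")
  unfolding orthogonal_sum_def
proof
  have mem_Z: "z \<in> ?Z \<longleftrightarrow> c * ((1 - q) * z) = z" for z
    using mem_right_ideal_gen_idempotent_iff[OF idempotent_c] by (simp add: mult.assoc)
  show "?Z = ?X + ?Y"
  proof (intro equalityI subsetI)
    fix z assume "z \<in> ?Z"
    then have z: "z = c * ((1 - q) * z)"
      using mem_Z by simp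
    have "e * z = 0"
      by (subst z) (simp add: mult_eq_assoc[OF e_c])
    then have "p * z \<in> ?X"
      by (simp add: mem_range_p mem_sum_of_complements mult_eq_assoc[OF idem_p]
          mult_eq_assoc[OF e_p])
    moreover have "z - p * z \<in> ?Y"
    proof -
      have "q * (1 - p) * c = (1 - q * p) * c - (1 - q) * c"
        by (simp add: algebra_simps)
      then have "q * (1 - p) * c = q - e"
        unfolding mult_c q_complement_c by simp
      then have "q * (1 - p) * z = (q - e) * ((1 - q) * z)"
        by (subst z) (simp add: mult_eq_assoc)
      also have "\<dots> = 0"
        by (simp add: algebra_simps mult_eq_assoc[OF idem_q] mult_eq_assoc[OF e_q])
      finally show ?thesis
        by (simp add: mem_range_p_complement mem_range_q_complement algebra_simps
            mult_eq_assoc[OF idem_p])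
    qed
    moreover have "z = p * z + (z - p * z)"
      by simp
    ultimately show "z \<in> ?X + ?Y"
      unfolding set_plus_def by blast
  next
    fix z assume "z \<in> ?X + ?Y"
    then obtain u v where z: "z = u + v" and "u \<in> ?X" "v \<in> ?Y"
      by (rule set_plus_elim)
    then have u: "p * u = u" "e * u = 0" and v: "p * v = 0" "q * v = 0"
      by (simp_all add: mem_range_p mem_sum_of_complements mem_range_p_complement
          mem_range_q_complement)
    have "(1 - q) * u = (1 - q * p) * u"
      by (simp add: left_diff_distrib mult.assoc u)
    then have "c * ((1 - q) * u) = u"
      using mult_eq_assoc[OF c_mult, of u] by (simp add: left_diff_distrib[of 1 e] u)
    moreover have "c * ((1 - q) * v) = v"
      using mult_eq_assoc[OF c_p_complement, of v] by (simp add: left_diff_distrib v)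
    ultimately show "z \<in> ?Z"
      by (simp add: mem_Z z distrib_left)
  qed
  show "star_orthogonal star ?X ?Y"
    unfolding star_orthogonal_def
  proof (intro ballI)
    fix u v assume "u \<in> ?X" "v \<in> ?Y"
    then have "p * u = u" "p * v = 0"
      by (auto simp: mem_range_p mem_range_p_complement)
    then show "star v * u = 0"
      by (metis star_mult star_p star_zero mult.assoc mult_zero_left)
  qed
qed

lemma orthogonal_sum_kernel_p_mp_complement:
  "orthogonal_sum star (right_ideal_gen (1 - p * mp_complement))
    ((right_ideal_gen (1 - p) + right_ideal_gen (1 - q)) \<inter> right_ideal_gen q)
    (right_ideal_gen (1 - p) \<inter> right_ideal_gen (1 - q))"
  (is "orthogonal_sum star ?Z ?X ?Y")
  unfolding orthogonal_sum_def
proof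
  show "?Z = ?X + ?Y"
  proof (intro equalityI subsetI)
    fix z assume "z \<in> ?Z"
    then have z: "p * ((1 - q) * z) = 0" "e * z = 0"
      by (auto simp: mem_kernel_p_mp_complement)
    have "q * z \<in> ?X"
      using z by (simp add: mem_range_q mem_sum_of_complements mult_eq_assoc[OF idem_q]
          mult_eq_assoc[OF e_q])
    moreover have "z - q * z \<in> ?Y"
      using z by (simp add: mem_range_p_complement mem_range_q_complement algebra_simps
          mult_eq_assoc[OF idem_q])
    moreover have "z = q * z + (z - q * z)"
      by simp
    ultimately show "z \<in> ?X + ?Y"
      unfolding set_plus_def by blast
  next
    fix z assume "z \<in> ?X + ?Y"
    then obtain u v where z: "z = u + v" and "u \<in> ?X" "v \<in> ?Y"
      by (rule set_plus_elim)
    then have u: "q * u = u" "e * u = 0" and v: "p * v = 0" "q * v = 0"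
      by (simp_all add: mem_range_q mem_sum_of_complements mem_range_p_complement
          mem_range_q_complement)
    have "e * v = 0"
      using mult_eq_assoc[OF e_p, of v] v by simp
    then show "z \<in> ?Z"
      using u v by (simp add: mem_kernel_p_mp_complement z distrib_left left_diff_distrib)
  qed
  show "star_orthogonal star ?X ?Y"
    unfolding star_orthogonal_def
  proof (intro ballI)
    fix u v assume "u \<in> ?X" "v \<in> ?Y"
    then have "q * u = u" "q * v = 0"
      by (auto simp: mem_range_q mem_range_q_complement)
    then show "star v * u = 0"
      by (metis star_mult star_q star_zero mult.assoc mult_zero_left)
  qed
qed

end

section \<open>The theorem\<close>

theorem theorem12:
  fixes star :: "'a::{ring, monoid_mult} \<Rightarrow> 'a" and p q :: 'a
  assumes "ring_involution star"
    and "star_reducing star"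
    and "is_projection star p"
    and "is_projection star q"
    and "mp_invertible star (1 - q * p)"
  shows "mp_invertible star (p + q - q * p)
    \<and> idempotent_elem (mp_inverse star (1 - q * p) * (1 - q))
    \<and> idempotent_elem (p * mp_inverse star (p + q - q * p))
    \<and> orthogonal_sum star
        (right_ideal_gen (mp_inverse star (1 - q * p) * (1 - q)))
        (right_ideal_gen p \<inter> (right_ideal_gen (1 - p) + right_ideal_gen (1 - q)))
        (right_ideal_gen (1 - p) \<inter> right_ideal_gen (1 - q))
    \<and> right_ideal_gen (1 - mp_inverse star (1 - q * p) * (1 - q)) = right_ideal_gen q
    \<and> right_ideal_gen (p * mp_inverse star (p + q - q * p)) = right_ideal_gen p
    \<and> orthogonal_sum star
        (right_ideal_gen (1 - p * mp_inverse star (p + q - q * p)))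
        ((right_ideal_gen (1 - p) + right_ideal_gen (1 - q)) \<inter> right_ideal_gen q)
        (right_ideal_gen (1 - p) \<inter> right_ideal_gen (1 - q))"
proof -
  interpret mp_projection_pair star p q
    using assms by (simp add: mp_projection_pair_def mp_projection_pair_axioms_def)
  show ?thesis
    unfolding c_def[symmetric] mp_inverse_complement
    using is_mp_inverse_complement idempotent_c idempotent_p_mp_complement
      orthogonal_sum_range_c range_complement_c range_p_mp_complement
      orthogonal_sum_kernel_p_mp_complement
    unfolding mp_invertible_def by blast
qed

end
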